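(* Let $V$ be a nonzero cyclic $\mathfrak{A}$-module of type $i\in\{+,-,\ast\}$. Then, given its type, the isomorphism class of $V$ is uniquely determined by the dimension vector $\underline{\dim}(V)=(\dim V_-,\dim V_\ast,\dim V_+)$. For $d\in\mathbb{Z}_{\ge0}$, the possibilities are as follows. (I) Cyclic modules of type $\ast$. The possible dimension vectors are: (a) $(d,d+1,d)$, (b) $(d+1,d+1,d+1)$, (c) $(d,d+1,d+1)$, (d) $(d+1,d+1,d)$. For all these modules $m_\ast=d+1$. (II) Cyclic modules of type $+$. The possible dimension vectors are: (a) $(d,d,d+1)$, (b) $(d,d+1,d+1)$, (c) $(d+1,d+1,d+1)$, (d) $(d-1,d,d+1)$ (this one exists only for $d\ge1$). For these modules $m_+=d+1$. (III) Cyclic modules of type $-$. The possible dimension vectors are: (a) $(d+1,d,d)$, (b) $(d+1,d+1,d)$, (c) $(d+1,d+1,d+1)$, (d) $(d+1,d,d-1)$ (this one exists only for $d\ge1$). For these modules $m_-=d+1$.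
   Context: Let $\mathfrak{D}=\mathbb{C}[[t]]$, $\mathfrak{m}=(t)$ and $$\mathfrak{A}=\begin{pmatrix}\mathfrak{D}&\mathfrak{m}&\mathfrak{m}\\\mathfrak{D}&\mathfrak{D}&\mathfrak{m}\\\mathfrak{D}&\mathfrak{m}&\mathfrak{D}\end{pmatrix}\subset\mathrm{Mat}_{3\times3}(\mathfrak{D}).$$ Let $E_{ij}$ be the matrix units and $e_\ast=E_{11}$, $e_+=E_{22}$, $e_-=E_{33}$. The modules $P_i=\mathfrak{A}e_i$, $i\in\{\ast,+,-\}$, are, up to isomorphism, all indecomposable projective $\mathfrak{A}$-modules. A finite dimensional (over $\mathbb{C}$) left $\mathfrak{A}$-module $V$ is cyclic if there is an epimorphism $P\twoheadrightarrow V$ with $P$ indecomposable projective; it is cyclic of type $i$ if there is an epimorphism $P_i\twoheadrightarrow V$. Put $V_i=e_iV$. Let $A_\pm:V_\pm\to V_\ast$ and $B_\pm:V_\ast\to V_\pm$ be the actions of $a_+=tE_{12}$, $a_-=tE_{13}$, $b_+=E_{21}$, $b_-=E_{31}$, respectively; thus $A_+B_+=A_-B_-$ (this identifies finite dimensional $\mathfrak{A}$-modules with finite dimensional nilpotent representations of the Gelfand quiver). Put $C_\ast=A_+B_+=A_-B_-\in\mathrm{End}(V_\ast)$ and $C_\pm=B_\pm A_\pm\in\mathrm{End}(V_\pm)$, and let $m_\ast,m_\pm$ be the nilpotency degrees of $C_\ast,C_\pm$, i.e. the least $m\ge 0$ with $C_\ast^{m}=0$, respectively $C_\pm^m=0$.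 *)

theory Defs
  imports
    "HOL-Computational_Algebra.Formal_Power_Series"
    "Jordan_Normal_Form.VS_Connect"
begin

section \<open>Left modules over a not necessarily commutative ring\<close>

text \<open>The locale \<^locale>\<open>module\<close> requires a commutative ring of scalars. Here the same axioms
  are imposed over an arbitrary ring. As there, the multiplication and the unit of the record
  of the module are ignored. Homomorphisms are those of \<^const>\<open>module_hom\<close>, whose definition
  makes sense over any ring.\<close>

locale left_module = R?: ring R + M?: abelian_group M
  for R :: "('a, 'r) ring_scheme" (structure)
    and M :: "('a, 'v, 'm) module_scheme" (structure) +
  assumes smult_closed:
      "\<lbrakk>a \<in> carrier R; x \<in> carrier M\<rbrakk> \<Longrightarrow> a \<odot>\<^bsub>M\<^esub> x \<in> carrier M"
    and smult_l_distr:
      "\<lbrakk>a \<in> carrier R; b \<in> carrier R; x \<in> carrier M\<rbrakk> \<Longrightarrow>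
       (a \<oplus> b) \<odot>\<^bsub>M\<^esub> x = a \<odot>\<^bsub>M\<^esub> x \<oplus>\<^bsub>M\<^esub> b \<odot>\<^bsub>M\<^esub> x"
    and smult_r_distr:
      "\<lbrakk>a \<in> carrier R; x \<in> carrier M; y \<in> carrier M\<rbrakk> \<Longrightarrow>
       a \<odot>\<^bsub>M\<^esub> (x \<oplus>\<^bsub>M\<^esub> y) = a \<odot>\<^bsub>M\<^esub> x \<oplus>\<^bsub>M\<^esub> a \<odot>\<^bsub>M\<^esub> y"
    and smult_assoc1:
      "\<lbrakk>a \<in> carrier R; b \<in> carrier R; x \<in> carrier M\<rbrakk> \<Longrightarrow>
       (a \<otimes> b) \<odot>\<^bsub>M\<^esub> x = a \<odot>\<^bsub>M\<^esub> (b \<odot>\<^bsub>M\<^esub> x)"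
    and smult_one:
      "x \<in> carrier M \<Longrightarrow> \<one> \<odot>\<^bsub>M\<^esub> x = x"

definition left_module_isomorphic ::
  "('a, 'r) ring_scheme \<Rightarrow> ('a, 'v, 'm) module_scheme \<Rightarrow> ('a, 'w, 'n) module_scheme \<Rightarrow> bool"
  where "left_module_isomorphic R M N \<longleftrightarrow>
    (\<exists>f \<in> module_hom R M N. bij_betw f (carrier M) (carrier N))"


section \<open>The order \<open>\<AA>\<close> and its indecomposable projective modules\<close>

text \<open>Matrix indices start at 0, so that the power series entry \<open>(i, j)\<close> below is the entry
  \<open>(i + 1, j + 1)\<close> in the usual numbering; \<^term>\<open>fps_X :: complex fps\<close> is the variable \<open>t\<close>.\<close>

definition gelfand_order :: "complex fps mat ring" ("\<AA>")
  where "\<AA> = (ring_mat TYPE(complex fps) 3 ())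
    \<lparr>carrier := {M \<in> carrier_mat 3 3.
       fps_X dvd M $$ (0, 1) \<and> fps_X dvd M $$ (0, 2) \<and>
       fps_X dvd M $$ (1, 2) \<and> fps_X dvd M $$ (2, 1)}\<rparr>"

datatype vertex = Star | Plus | Minus

primrec vertex_index :: "vertex \<Rightarrow> nat" where
  "vertex_index Star = 0"
| "vertex_index Plus = 1"
| "vertex_index Minus = 2"

definition matrix_unit :: "vertex \<Rightarrow> vertex \<Rightarrow> complex fps mat"
  where "matrix_unit i j =
    mat 3 3 (\<lambda>(r, s). if r = vertex_index i \<and> s = vertex_index j then 1 else 0)"

definition idem :: "vertex \<Rightarrow> complex fps mat"
  where "idem i = matrix_unit i i"

definition projective :: "vertex \<Rightarrow> (complex fps mat, complex fps mat) module"
  where "projective i =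
    \<lparr>carrier = (\<lambda>M. M * idem i) ` carrier \<AA>, mult = (*), one = idem i,
     zero = 0\<^sub>m 3 3, add = (+), smult = (*)\<rparr>"


section \<open>Finite dimensional and cyclic modules\<close>

text \<open>The complex vector space underlying an \<open>\<AA>\<close>-module, the scalars acting through the
  constant scalar matrices.\<close>

definition complex_space ::
  "(complex fps mat, 'v) module \<Rightarrow> (complex, 'v) module"
  where "complex_space V =
    \<lparr>carrier = carrier V, mult = mult V, one = one V, zero = zero V, add = add V,
     smult = (\<lambda>c v. (fps_const c \<cdot>\<^sub>m 1\<^sub>m 3) \<odot>\<^bsub>V\<^esub> v)\<rparr>"

definition fin_dim_module :: "(complex fps mat, 'v) module \<Rightarrow> bool"
  where "fin_dim_module V \<longleftrightarrow>
    left_module \<AA> V \<and> vectorspace.fin_dim class_ring (complex_space V)"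

definition nonzero_module :: "('a, 'v) module \<Rightarrow> bool"
  where "nonzero_module V \<longleftrightarrow> carrier V \<noteq> {\<zero>\<^bsub>V\<^esub>}"

definition cyclic_of_type :: "vertex \<Rightarrow> (complex fps mat, 'v) module \<Rightarrow> bool"
  where "cyclic_of_type i V \<longleftrightarrow> fin_dim_module V \<and>
    (\<exists>h \<in> module_hom \<AA> (projective i) V. h ` carrier (projective i) = carrier V)"

definition component :: "(complex fps mat, 'v) module \<Rightarrow> vertex \<Rightarrow> 'v set"
  where "component V i = (\<lambda>v. idem i \<odot>\<^bsub>V\<^esub> v) ` carrier V"

definition component_dim :: "(complex fps mat, 'v) module \<Rightarrow> vertex \<Rightarrow> nat"
  where "component_dim V i =
    vectorspace.dim class_ring ((complex_space V) \<lparr>carrier := component V i\<rparr>)"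

definition dimension_vector :: "(complex fps mat, 'v) module \<Rightarrow> nat \<times> nat \<times> nat"
  where "dimension_vector V =
    (component_dim V Minus, component_dim V Star, component_dim V Plus)"


section \<open>The actions of the arrows and the nilpotency degrees\<close>

text \<open>The maps are given on all of \<open>V\<close>; they are meant to be applied to elements of the
  components \<open>V\<^sub>+\<close>, \<open>V\<^sub>-\<close> (for \<open>A\<close>) and \<open>V\<^sub>*\<close> (for \<open>B\<close>).\<close>

definition A_plus :: "(complex fps mat, 'v) module \<Rightarrow> 'v \<Rightarrow> 'v"
  where "A_plus V v = (fps_X \<cdot>\<^sub>m matrix_unit Star Plus) \<odot>\<^bsub>V\<^esub> v"

definition A_minus :: "(complex fps mat, 'v) module \<Rightarrow> 'v \<Rightarrow> 'v"
  where "A_minus V v = (fps_X \<cdot>\<^sub>m matrix_unit Star Minus) \<odot>\<^bsub>V\<^esub> v"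

definition B_plus :: "(complex fps mat, 'v) module \<Rightarrow> 'v \<Rightarrow> 'v"
  where "B_plus V v = matrix_unit Plus Star \<odot>\<^bsub>V\<^esub> v"

definition B_minus :: "(complex fps mat, 'v) module \<Rightarrow> 'v \<Rightarrow> 'v"
  where "B_minus V v = matrix_unit Minus Star \<odot>\<^bsub>V\<^esub> v"

text \<open>For \<open>Star\<close>, composing \<open>A_minus\<close> with \<open>B_minus\<close> gives the same map, see
  \<open>A_plus_B_plus_eq\<close> below.\<close>

primrec C_op :: "(complex fps mat, 'v) module \<Rightarrow> vertex \<Rightarrow> 'v \<Rightarrow> 'v" where
  "C_op V Star = A_plus V \<circ> B_plus V"
| "C_op V Plus = B_plus V \<circ> A_plus V"
| "C_op V Minus = B_minus V \<circ> A_minus V"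

definition nilpotency_degree :: "(complex fps mat, 'v) module \<Rightarrow> vertex \<Rightarrow> nat"
  where "nilpotency_degree V i =
    (LEAST m. \<forall>v \<in> component V i. (C_op V i ^^ m) v = \<zero>\<^bsub>V\<^esub>)"

text \<open>Existence of a nonzero cyclic module with given dimension vector. A bound variable needs
  a fixed carrier type; columns of power series are large enough for all finite dimensional
  complex vector spaces.\<close>

definition realised :: "vertex \<Rightarrow> nat \<times> nat \<times> nat \<Rightarrow> bool"
  where "realised i x \<longleftrightarrow>
    (\<exists>V :: (complex fps mat, complex fps vec) module.
       cyclic_of_type i V \<and> nonzero_module V \<and> dimension_vector V = x)"


section \<open>Basic facts\<close>

lemma gelfand_order_simps:
  "mult \<AA> = (*)" "add \<AA> = (+)" "one \<AA> = 1\<^sub>m 3" "zero \<AA> = 0\<^sub>m 3 3"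
  "carrier \<AA> = {M \<in> carrier_mat 3 3. fps_X dvd M $$ (0, 1) \<and> fps_X dvd M $$ (0, 2) \<and>
       fps_X dvd M $$ (1, 2) \<and> fps_X dvd M $$ (2, 1)}"
  by (simp_all add: gelfand_order_def ring_mat_simps)

lemma mult_3_index:
  assumes "M \<in> carrier_mat 3 3" "N \<in> carrier_mat 3 3" "i < 3" "j < 3"
  shows "(M * N) $$ (i, j) =
    M $$ (i, 0) * N $$ (0, j) + M $$ (i, 1) * N $$ (1, j) + M $$ (i, 2) * N $$ (2, j)"
  using assms by (auto simp: times_mat_def scalar_prod_def eval_nat_numeral)

lemma ring_gelfand_order: "ring \<AA>"
proof (rule ringI)
  show "abelian_group \<AA>"
  proof (rule abelian_groupI)
    fix M assume M: "M \<in> carrier \<AA>"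
    have "- M \<in> carrier \<AA>" "- M + M = 0\<^sub>m 3 3"
      using M by (auto simp: gelfand_order_simps uminus_l_inv_mat)
    then show "\<exists>N \<in> carrier \<AA>. N \<oplus>\<^bsub>\<AA>\<^esub> M = \<zero>\<^bsub>\<AA>\<^esub>"
      unfolding gelfand_order_simps by blast
  qed (auto simp: gelfand_order_simps comm_add_mat[of _ 3 3] assoc_add_mat[of _ 3 3])
  show "Group.monoid \<AA>"
    by (rule monoidI)
      (auto simp: gelfand_order_simps mult_3_index assoc_mult_mat[of _ 3 3 _ 3 _ 3]
         simp del: index_mult_mat)
qed (auto simp: gelfand_order_simps add_mult_distrib_mat[of _ 3 3 _ _ 3]
       mult_add_distrib_mat[of _ 3 3 _ 3])

lemma matrix_unit_in_gelfand_order: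
  "idem i \<in> carrier \<AA>"
  "fps_X \<cdot>\<^sub>m matrix_unit i j \<in> carrier \<AA>"
  "matrix_unit i Star \<in> carrier \<AA>"
  by (cases i; cases j; simp add: gelfand_order_simps idem_def matrix_unit_def)+

lemma left_module_projective: "left_module \<AA> (projective i)"
proof -
  interpret ring \<AA> by (rule ring_gelfand_order)
  note e = matrix_unit_in_gelfand_order(1)[of i]
  have sub: "M \<in> carrier \<AA>" if "M \<in> carrier (projective i)" for M
    using that m_closed[OF _ e] by (auto simp: projective_def gelfand_order_simps(1))
  have mem: "N \<in> carrier (projective i) \<longleftrightarrow> (\<exists>M \<in> carrier \<AA>. N = M \<otimes>\<^bsub>\<AA>\<^esub> idem i)" for N
    by (auto simp: projective_def gelfand_order_simps(1))
  have clM: "M \<otimes>\<^bsub>\<AA>\<^esub> N \<in> carrier (projective i)"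
    if "M \<in> carrier \<AA>" "N \<in> carrier (projective i)" for M N
    using that m_closed[of M] m_assoc[OF _ _ e] unfolding mem by metis
  have clA: "M \<oplus>\<^bsub>\<AA>\<^esub> N \<in> carrier (projective i)"
    if "M \<in> carrier (projective i)" "N \<in> carrier (projective i)" for M N
    using that l_distr[OF _ _ e] a_closed unfolding mem by metis
  have z: "\<zero>\<^bsub>\<AA>\<^esub> \<in> carrier (projective i)"
    using l_null[OF e] zero_closed unfolding mem by metis
  have fields: "zero (projective i) = zero \<AA>" "add (projective i) = add \<AA>"
    "smult (projective i) = mult \<AA>"
    by (simp_all add: projective_def gelfand_order_simps)
  show ?thesis
  proof (intro left_module.intro left_module_axioms.intro ring_gelfand_order abelian_groupI)
    fix M assume M: "M \<in> carrier (projective i)"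
    have "(\<ominus>\<^bsub>\<AA>\<^esub> \<one>\<^bsub>\<AA>\<^esub>) \<otimes>\<^bsub>\<AA>\<^esub> M \<oplus>\<^bsub>\<AA>\<^esub> M = \<zero>\<^bsub>\<AA>\<^esub>"
      using sub[OF M] l_minus l_neg by simp
    moreover have "(\<ominus>\<^bsub>\<AA>\<^esub> \<one>\<^bsub>\<AA>\<^esub>) \<otimes>\<^bsub>\<AA>\<^esub> M \<in> carrier (projective i)"
      using clM[OF _ M] by simp
    ultimately show "\<exists>N \<in> carrier (projective i).
        N \<oplus>\<^bsub>projective i\<^esub> M = \<zero>\<^bsub>projective i\<^esub>"
      unfolding fields by blast
  next
    fix M N assume "M \<in> carrier (projective i)" "N \<in> carrier (projective i)"
    then show "M \<oplus>\<^bsub>projective i\<^esub> N = N \<oplus>\<^bsub>projective i\<^esub> M"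
      unfolding fields by (intro a_comm sub)
  qed (use clA clM z in \<open>auto simp: fields a_assoc l_distr r_distr m_assoc sub\<close>)
qed

lemma A_plus_B_plus_eq:
  assumes "left_module \<AA> V" "v \<in> carrier V"
  shows "A_plus V (B_plus V v) = A_minus V (B_minus V v)"
proof -
  interpret left_module \<AA> V by fact
  have "(fps_X \<cdot>\<^sub>m matrix_unit Star Plus) * matrix_unit Plus Star
      = (fps_X \<cdot>\<^sub>m matrix_unit Star Minus) * matrix_unit Minus Star"
    by (rule eq_matI) (auto simp: matrix_unit_def scalar_prod_def eval_nat_numeral)
  then show ?thesis
    using smult_assoc1[OF matrix_unit_in_gelfand_order(2,3) assms(2)]
    unfolding A_plus_def B_plus_def A_minus_def B_minus_def gelfand_order_simps(1)
    by metis
qed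

end

theory Submission
  imports Defs
begin

text \<open>The component at \<open>r\<close> of \<open>P\<^sub>i\<close> is the ideal generated by \<open>t^v\<close> in \<open>\<complex>[[t]]\<close>, where \<open>v\<close> is 0 or 1
  (\<open>vanishing r i\<close> below). A submodule of finite codimension is given by ideals \<open>(t^(n r))\<close>
  inside these components, and stability under \<open>\<AA>\<close> means \<open>n r \<le> n s + vanishing r s\<close>. The
  quotient has dimension \<open>n r - vanishing r i\<close> at \<open>r\<close>, so the dimension vector recovers
  \<open>n\<close>, hence the submodule; and \<open>C\<close> acts on the component at \<open>i\<close> as multiplication by \<open>t\<close> on
  \<open>\<complex>[[t]] / (t^(n i))\<close>, so its nilpotency degree is \<open>n i\<close>. The cases of each type
  are the solutions of the inequalities for fixed \<open>n i\<close>.\<close>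

section \<open>Linear maps on ideals of power series\<close>

lemma fps_X_power_dvd_iff:
  fixes x :: "'a::field fps"
  shows "fps_X ^ n dvd x \<longleftrightarrow> x = 0 \<or> n \<le> subdegree x"
  by (cases "x = 0") (simp_all add: fps_dvd_iff fps_X_power_subdegree)

lemma fps_X_power_dvd_power_iff [simp]:
  "(fps_X :: 'a::field fps) ^ m dvd fps_X ^ n \<longleftrightarrow> m \<le> n"
  by (simp add: fps_X_power_dvd_iff fps_X_power_subdegree)

lemma fps_cutoff_eq_iff_dvd:
  fixes x y :: "'a::field fps"
  shows "fps_cutoff n x = fps_cutoff n y \<longleftrightarrow> fps_X ^ n dvd x - y"
proof -
  have "fps_cutoff n x = fps_cutoff n y \<longleftrightarrow> fps_cutoff n (x - y) = 0"
    by (simp add: fps_cutoff_diff)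
  then show ?thesis
    by (simp add: fps_cutoff_zero_iff fps_X_power_dvd_iff)
qed

text \<open>An element of least subdegree \<open>n\<close> in \<open>I\<close> is associated to
  \<open>t^n\<close>, because \<open>\<complex>[[t]]\<close> and its analogues over any field are
  discrete valuation rings. Hence it divides every series of subdegree at least
  \<open>n\<close>.\<close>

lemma fps_ideal_principal:
  fixes I :: "'a::field fps set"
  assumes mult: "\<And>x y. y \<in> I \<Longrightarrow> x * y \<in> I" and z: "z \<in> I" "z \<noteq> 0"
  obtains n where "I = {x. fps_X ^ n dvd x}"
proof -
  define n where "n = (LEAST n. \<exists>x \<in> I. x \<noteq> 0 \<and> subdegree x = n)"
  have "\<exists>x \<in> I. x \<noteq> 0 \<and> subdegree x = n"
    unfolding n_def by (rule LeastI_ex) (use z in blast)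
  then obtain x where x: "x \<in> I" "x \<noteq> 0" "subdegree x = n"
    by blast
  have "n \<le> subdegree y" if "y \<in> I" "y \<noteq> 0" for y
    unfolding n_def by (rule Least_le) (use that in blast)
  then have "fps_X ^ n dvd y" if "y \<in> I" for y
    using that by (auto simp: fps_X_power_dvd_iff)
  moreover have "y \<in> I" if "fps_X ^ n dvd y" for y
  proof -
    have "x dvd fps_X ^ n"
      using x by (simp add: fps_dvd_iff fps_X_power_subdegree)
    then have "x dvd y"
      using that by (rule dvd_trans)
    then show ?thesis
      using mult[OF x(1)] by (metis dvd_def mult.commute)
  qed
  ultimately show ?thesis
    using that by blast
qed

lemma fps_nth_sum_monomials:
  fixes c :: "nat \<Rightarrow> 'a::comm_ring_1"
  assumes "finite K"
  shows "fps_nth (\<Sum>k\<in>K. fps_const (c k) * fps_X ^ k) j = (if j \<in> K then c j else 0)"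
proof -
  have "fps_nth (fps_const (c k) * fps_X ^ k) j = (if j = k then c k else 0)" for k
    by simp
  then show ?thesis
    using assms by (simp add: fps_sum_nth sum.delta')
qed

text \<open>The coefficients below \<open>p\<close> vanish, so the monomials from \<open>p\<close>
  to \<open>n - 1\<close> make up all of \<open>x\<close> modulo \<open>t^n\<close>. This is why
  finitely many powers of \<open>t\<close> will span a quotient of ideals.\<close>

lemma fps_X_power_dvd_diff_monomials:
  fixes x :: "'a::field fps"
  assumes "fps_X ^ p dvd x"
  shows "fps_X ^ n dvd x - (\<Sum>k = p..<n. fps_const (fps_nth x k) * fps_X ^ k)"
  unfolding fps_cutoff_eq_iff_dvd[symmetric]
proof (rule fps_ext)
  fix j
  have "fps_nth x j = 0" if "j < p"
    using assms that by (auto simp: fps_X_power_dvd_iff intro: nth_less_subdegree_zero)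
  then show "fps_nth (fps_cutoff n x) j
      = fps_nth (fps_cutoff n (\<Sum>k = p..<n. fps_const (fps_nth x k) * fps_X ^ k)) j"
    by (simp add: fps_nth_sum_monomials)
qed

text \<open>A linear map from the ideal \<open>(t^p)\<close> to \<open>W\<close>. The function
  \<open>g\<close> is total and only its values on the ideal are constrained, so the source needs no
  module record of its own.\<close>

locale power_series_map = vectorspace "class_ring :: 'a ring" W
  for W :: "('a::field, 'v, 'm) module_scheme" +
  fixes p :: nat and g :: "'a fps \<Rightarrow> 'v"
  assumes map_closed: "fps_X ^ p dvd x \<Longrightarrow> g x \<in> carrier W"
    and map_add: "\<lbrakk>fps_X ^ p dvd x; fps_X ^ p dvd y\<rbrakk> \<Longrightarrow> g (x + y) = g x \<oplus>\<^bsub>W\<^esub> g y"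
    and map_smult: "fps_X ^ p dvd x \<Longrightarrow> g (fps_const c * x) = c \<odot>\<^bsub>W\<^esub> g x"
begin

abbreviation comb :: "nat set \<Rightarrow> (nat \<Rightarrow> 'a) \<Rightarrow> 'a fps"
  where "comb K c \<equiv> (\<Sum>k\<in>K. fps_const (c k) * fps_X ^ k)"

lemma comb_dvd: "K \<subseteq> {p..} \<Longrightarrow> fps_X ^ p dvd comb K c"
  by (intro dvd_sum dvd_mult) auto

lemma map_zero: "g 0 = \<zero>\<^bsub>W\<^esub>"
proof -
  have "g (fps_const 0 * 0) = 0 \<odot>\<^bsub>W\<^esub> g 0"
    by (rule map_smult) simp
  also have "\<dots> = \<zero>\<^bsub>W\<^esub>"
    using lmult_0[OF map_closed[of 0]] by simp
  finally show ?thesis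
    by simp
qed

lemma map_comb:
  assumes "finite K" "K \<subseteq> {p..}"
  shows "g (comb K c) = (\<Oplus>\<^bsub>W\<^esub>k\<in>K. c k \<odot>\<^bsub>W\<^esub> g (fps_X ^ k))"
  using assms
proof (induction K)
  case (insert k K)
  have "fps_X ^ p dvd fps_const (c k) * fps_X ^ k"
    using insert.prems by (intro dvd_mult) auto
  moreover have "(\<lambda>k. c k \<odot>\<^bsub>W\<^esub> g (fps_X ^ k)) \<in> insert k K \<rightarrow> carrier W"
    using insert.prems by (auto intro!: smult_closed map_closed)
  ultimately show ?case
    using insert by (simp add: map_add comb_dvd map_smult)
qed (simp add: map_zero)

lemma lincomb_powers:
  assumes "finite K" "K \<subseteq> {p..}" "inj_on (\<lambda>k. g (fps_X ^ k)) K"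
  shows "lincomb a ((\<lambda>k. g (fps_X ^ k)) ` K) = g (comb K (\<lambda>k. a (g (fps_X ^ k))))"
  unfolding lincomb_def using assms
  by (subst finsum_reindex) (auto simp: map_comb intro!: smult_closed map_closed)

text \<open>Independence of the image set alone would not notice that two powers have the same
  image, so injectivity is established as well. It is also what lets cardinalities be compared with
  dimensions.\<close>

lemma powers_independent:
  assumes "finite K" "K \<subseteq> {p..}"
    and ker: "\<And>c. g (comb K c) = \<zero>\<^bsub>W\<^esub> \<Longrightarrow> comb K c = 0"
  shows "inj_on (\<lambda>k. g (fps_X ^ k)) K" "lin_indpt ((\<lambda>k. g (fps_X ^ k)) ` K)"
proof -
  show inj: "inj_on (\<lambda>k. g (fps_X ^ k)) K"
  proof (rule inj_onI, rule ccontr)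
    fix k l assume kl: "k \<in> K" "l \<in> K" "g (fps_X ^ k) = g (fps_X ^ l)" "k \<noteq> l"
    \<comment> \<open>These coefficients give \<open>t^k - t^l\<close>, which \<open>g\<close> would
      kill although it is a nonzero combination.\<close>
    let ?c = "(\<lambda>j. if j = k then 1 else if j = l then - 1 else 0) :: nat \<Rightarrow> 'a"
    have "comb K ?c = comb {k, l} ?c"
      using kl assms(1) by (intro sum.mono_neutral_right) auto
    also have "\<dots> = fps_X ^ k + fps_const (- 1) * fps_X ^ l"
      using kl by simp
    finally have c: "comb K ?c = fps_X ^ k + fps_const (- 1) * fps_X ^ l" .
    have dvd: "fps_X ^ p dvd (fps_X :: 'a fps) ^ k" "fps_X ^ p dvd (fps_X :: 'a fps) ^ l"
      "fps_X ^ p dvd fps_const (- 1 :: 'a) * fps_X ^ l"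
      using kl assms(2) by (auto intro!: dvd_mult)
    have "g (comb K ?c) = g (fps_X ^ l + fps_const (- 1) * fps_X ^ l)"
      unfolding c map_add[OF dvd(1,3)] map_add[OF dvd(2,3)] kl(3) ..
    also have "fps_X ^ l + fps_const (- 1) * fps_X ^ l = (0 :: 'a fps)"
      by (simp add: fps_const_neg[symmetric] del: fps_const_neg)
    finally have "g (comb K ?c) = \<zero>\<^bsub>W\<^esub>"
      by (simp only: map_zero)
    then have "comb K ?c = 0"
      by (rule ker)
    then show False
      using fps_nth_sum_monomials[OF assms(1), of ?c k] kl(1) by simp
  qed
  show "lin_indpt ((\<lambda>k. g (fps_X ^ k)) ` K)"
  proof (rule finite_lin_indpt2)
    fix a assume "lincomb a ((\<lambda>k. g (fps_X ^ k)) ` K) = \<zero>\<^bsub>W\<^esub>"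
    then have "comb K (\<lambda>k. a (g (fps_X ^ k))) = 0"
      unfolding lincomb_powers[OF assms(1,2) inj] by (rule ker)
    then have "a (g (fps_X ^ k)) = 0" if "k \<in> K" for k
      using fps_nth_sum_monomials[OF assms(1), of "\<lambda>k. a (g (fps_X ^ k))" k] that by simp
    then show "\<forall>v \<in> (\<lambda>k. g (fps_X ^ k)) ` K. a v = \<zero>\<^bsub>class_ring\<^esub>"
      by auto
  qed (use assms map_closed in auto)
qed

text \<open>The ideal has infinite dimension, so no linear map from it to a finite dimensional space
  is injective.\<close>

lemma finite_dim_kernel:
  assumes "fin_dim"
  shows "\<exists>x. fps_X ^ p dvd x \<and> x \<noteq> 0 \<and> g x = \<zero>\<^bsub>W\<^esub>"
proof (rule ccontr)
  assume "\<not> ?thesis"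
  then have ker: "x = 0" if "fps_X ^ p dvd x" "g x = \<zero>\<^bsub>W\<^esub>" for x
    using that by blast
  \<comment> \<open>This interval has \<open>dim + 1\<close> elements, one more than an independent
    set may have.\<close>
  let ?K = "{p..p + dim}"
  have K: "finite ?K" "?K \<subseteq> {p..}"
    by auto
  have ind: "inj_on (\<lambda>k. g (fps_X ^ k)) ?K" "lin_indpt ((\<lambda>k. g (fps_X ^ k)) ` ?K)"
    by (rule powers_independent[OF K ker[OF comb_dvd[OF K(2)]]], assumption)+
  have "(\<lambda>k. g (fps_X ^ k)) ` ?K \<subseteq> carrier W"
    by (auto intro!: map_closed)
  then have "card ?K \<le> dim"
    using li_le_dim(2)[OF assms _ ind(2)] card_image[OF ind(1)] by simp
  then show False
    by simp
qed

section \<open>The powers from \<open>p\<close> to \<open>n - 1\<close> as a basis of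
  \<open>(t^p) / (t^n)\<close>\<close>

context
  fixes n :: nat
  assumes le: "p \<le> n"
    and ker: "\<And>x. fps_X ^ p dvd x \<Longrightarrow> g x = \<zero>\<^bsub>W\<^esub> \<longleftrightarrow> fps_X ^ n dvd x"
begin

lemma powers_independent_below:
  "inj_on (\<lambda>k. g (fps_X ^ k)) {p..<n}" "lin_indpt ((\<lambda>k. g (fps_X ^ k)) ` {p..<n})"
proof -
  let ?K = "{p..<n}"
  have K: "finite ?K" "?K \<subseteq> {p..}"
    by auto
  have ker0: "comb ?K c = 0" if "g (comb ?K c) = \<zero>\<^bsub>W\<^esub>" for c
  proof -
    have "fps_X ^ n dvd comb ?K c"
      using ker[OF comb_dvd[OF K(2)]] that by blast
    moreover have "fps_nth (comb ?K c) k = 0" if "k \<ge> n" for k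
      using that by (simp add: fps_nth_sum_monomials)
    \<comment> \<open>A nonzero combination would have subdegree at least \<open>n\<close>, where
      all its coefficients vanish; but the coefficient at the subdegree never does.\<close>
    ultimately have "comb ?K c \<noteq> 0 \<Longrightarrow> fps_nth (comb ?K c) (subdegree (comb ?K c)) = 0"
      unfolding fps_X_power_dvd_iff by blast
    then show ?thesis
      by (meson nth_subdegree_nonzero)
  qed
  show "inj_on (\<lambda>k. g (fps_X ^ k)) ?K" "lin_indpt ((\<lambda>k. g (fps_X ^ k)) ` ?K)"
    by (rule powers_independent[OF K ker0], assumption)+
qed

text \<open>The series differs from its truncated expansion by a multiple of \<open>t^n\<close>,
  which \<open>g\<close> kills.\<close>

lemma map_in_span:
  assumes x: "fps_X ^ p dvd x"
  shows "g x \<in> span ((\<lambda>k. g (fps_X ^ k)) ` {p..<n})"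
proof -
  let ?K = "{p..<n}"
  let ?A = "(\<lambda>k. g (fps_X ^ k)) ` ?K"
  have K: "finite ?K" "?K \<subseteq> {p..}"
    by auto
  have A: "finite ?A" "?A \<subseteq> carrier W"
    by (auto intro!: map_closed)
  note inj = powers_independent_below(1)
  let ?y = "comb ?K (fps_nth x)"
  have y: "fps_X ^ n dvd x - ?y"
    by (rule fps_X_power_dvd_diff_monomials[OF x])
  have p: "fps_X ^ p dvd x - ?y"
    using y le by (meson dvd_trans fps_X_power_dvd_power_iff)
  have "g x = g (?y + (x - ?y))"
    by simp
  also have "\<dots> = g ?y"
    unfolding map_add[OF comb_dvd[OF K(2)] p] ker[OF p, THEN iffD2, OF y]
    by (rule r_zero[OF map_closed[OF comb_dvd[OF K(2)]]])
  \<comment> \<open>The coefficients of \<open>lincomb\<close> are indexed by vectors, so the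
    exponent is recovered from \<open>g (fps_X ^ k)\<close> by the inverse of the injection.\<close>
  also have "?y = comb ?K (\<lambda>k. fps_nth x (the_inv_into ?K (\<lambda>k. g (fps_X ^ k)) (g (fps_X ^ k))))"
    by (rule sum.cong) (simp_all add: the_inv_into_f_f[OF inj])
  finally have "g x = lincomb (\<lambda>w. fps_nth x (the_inv_into ?K (\<lambda>k. g (fps_X ^ k)) w)) ?A"
    unfolding lincomb_powers[OF K inj] .
  then show ?thesis
    unfolding finite_span[OF A] by (intro CollectI exI conjI) simp_all
qed

lemma dim_image:
  assumes surj: "g ` {x. fps_X ^ p dvd x} = carrier W"
  shows "dim = n - p"
proof -
  let ?A = "(\<lambda>k. g (fps_X ^ k)) ` {p..<n}"
  have A: "finite ?A" "?A \<subseteq> carrier W"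
    by (auto intro!: map_closed)
  have "carrier W \<subseteq> span ?A"
    unfolding surj[symmetric] by (intro image_subsetI map_in_span) simp
  then have "basis ?A"
    unfolding basis_def using powers_independent_below(2) A(2) span_is_subset2[OF A(2)] by blast
  then have "dim = card ?A"
    by (rule dim_basis[OF A(1)])
  also have "\<dots> = n - p"
    using card_image[OF powers_independent_below(1)] by simp
  finally show ?thesis .
qed

end

end

section \<open>Images of left modules\<close>

text \<open>Two quotients of \<open>P\<close> with the same fibres: \<open>g\<close> factors through
  \<open>f\<close>, and the factor is bijective.\<close>

lemma left_module_isomorphicI:
  assumes P: "left_module R P"
    and f: "f \<in> module_hom R P M" "f ` carrier P = carrier M"
    and g: "g \<in> module_hom R P N" "g ` carrier P = carrier N"
    and ker: "\<And>x y. x \<in> carrier P \<Longrightarrow> y \<in> carrier P \<Longrightarrow> f x = f y \<longleftrightarrow> g x = g y"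
  shows "left_module_isomorphic R M N"
proof -
  interpret P: left_module R P by (rule P)
  \<comment> \<open>The preimage under \<open>f\<close> is arbitrary; \<open>ker\<close> makes its
    image under \<open>g\<close> independent of the choice.\<close>
  define k where "k = g \<circ> inv_into (carrier P) f"
  have k: "k (f x) = g x" if "x \<in> carrier P" for x
    unfolding k_def comp_def
    using ker[OF inv_into_into[of "f x" f "carrier P"] that] f_inv_into_f[of "f x" f "carrier P"] that
    by blast
  have "k \<in> module_hom R M N"
    unfolding module_hom_def f(2)[symmetric]
  proof (intro CollectI conjI allI impI)
    show "k \<in> f ` carrier P \<rightarrow> carrier N"
      using g(2) by (auto simp: k)
    fix m1 m2 assume "m1 \<in> f ` carrier P \<and> m2 \<in> f ` carrier P"
    then obtain x y where xy: "x \<in> carrier P" "y \<in> carrier P" "m1 = f x" "m2 = f y"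
      by blast
    then show "k (m1 \<oplus>\<^bsub>M\<^esub> m2) = k m1 \<oplus>\<^bsub>N\<^esub> k m2"
      using module_hom_add[OF f(1) xy(1,2)] module_hom_add[OF g(1) xy(1,2)] k[of "x \<oplus>\<^bsub>P\<^esub> y"]
      by (simp add: k)
  next
    fix r m assume "r \<in> carrier R \<and> m \<in> f ` carrier P"
    then obtain x where x: "r \<in> carrier R" "x \<in> carrier P" "m = f x"
      by blast
    then show "k (r \<odot>\<^bsub>M\<^esub> m) = r \<odot>\<^bsub>N\<^esub> k m"
      using module_hom_smult[OF f(1) x(1,2)] module_hom_smult[OF g(1) x(1,2)]
        k[of "r \<odot>\<^bsub>P\<^esub> x"] P.smult_closed[OF x(1,2)]
      by (simp add: k)
  qed
  moreover have "inj_on k (carrier M)"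
    unfolding f(2)[symmetric] by (auto intro!: inj_onI simp: k ker)
  moreover have "k ` carrier M = carrier N"
    unfolding f(2)[symmetric] g(2)[symmetric] image_image by (auto simp: k)
  ultimately show ?thesis
    unfolding left_module_isomorphic_def bij_betw_def by blast
qed

text \<open>Transport of structure: every element of \<open>V\<close> is some \<open>T x\<close>, so
  each module axiom is the image of the same axiom in \<open>P\<close>. The realising modules are
  built in this way.\<close>

lemma left_module_image:
  assumes P: "left_module R P"
    and carrier: "carrier V = T ` carrier P" and zero: "\<zero>\<^bsub>V\<^esub> = T \<zero>\<^bsub>P\<^esub>"
    and add: "\<And>x y. \<lbrakk>x \<in> carrier P; y \<in> carrier P\<rbrakk> \<Longrightarrow> T x \<oplus>\<^bsub>V\<^esub> T y = T (x \<oplus>\<^bsub>P\<^esub> y)"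
    and smult: "\<And>a x. \<lbrakk>a \<in> carrier R; x \<in> carrier P\<rbrakk> \<Longrightarrow> a \<odot>\<^bsub>V\<^esub> T x = T (a \<odot>\<^bsub>P\<^esub> x)"
  shows "left_module R V" "T \<in> module_hom R P V"
proof -
  interpret P: left_module R P by (rule P)
  show "left_module R V"
  proof (intro left_module.intro left_module_axioms.intro P.R.ring_axioms abelian_groupI)
    fix x assume "x \<in> carrier V"
    then obtain u where u: "u \<in> carrier P" "x = T u"
      unfolding carrier by blast
    have "T (\<ominus>\<^bsub>P\<^esub> u) \<oplus>\<^bsub>V\<^esub> x = \<zero>\<^bsub>V\<^esub>"
      using u by (simp add: add zero P.M.l_neg)
    then show "\<exists>y \<in> carrier V. y \<oplus>\<^bsub>V\<^esub> x = \<zero>\<^bsub>V\<^esub>"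
      unfolding carrier using P.M.a_inv_closed[OF u(1)] by blast
  qed (auto simp: carrier zero add smult P.smult_closed P.smult_l_distr P.smult_r_distr
      P.smult_assoc1 P.smult_one P.M.a_ac)
  show "T \<in> module_hom R P V"
    unfolding module_hom_def by (auto simp: carrier add smult)
qed

section \<open>Matrix entries in the order and its projective modules\<close>

definition entry :: "complex fps mat \<Rightarrow> vertex \<Rightarrow> vertex \<Rightarrow> complex fps"
  where "entry M r s = M $$ (vertex_index r, vertex_index s)"

definition unit_multiple :: "complex fps \<Rightarrow> vertex \<Rightarrow> vertex \<Rightarrow> complex fps mat"
  where "unit_multiple x r s = x \<cdot>\<^sub>m matrix_unit r s"

text \<open>The exponent matrix of the tiled order \<open>\<AA>\<close>: the entries at
  \<open>(r, s)\<close> form the ideal \<open>(t^(vanishing r s))\<close>.\<close>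

definition vanishing :: "vertex \<Rightarrow> vertex \<Rightarrow> nat"
  where "vanishing r s = (if s = Star \<or> r = s then 0 else 1)"

lemma vanishing_simps [simp]: "vanishing r r = 0" "vanishing r Star = 0"
  by (simp_all add: vanishing_def)

lemma all_vertex: "(\<forall>v. P v) \<longleftrightarrow> P Star \<and> P Plus \<and> P Minus"
  by (metis vertex.exhaust)

text \<open>In terms of exponents this expresses that \<open>\<AA>\<close> is closed under
  multiplication.\<close>

lemma vanishing_triangle: "vanishing r t \<le> vanishing r s + vanishing s t"
  by (cases r; cases s; cases t; simp add: vanishing_def)

lemma vertex_index_less [simp]: "vertex_index r < 3"
  by (cases r) simp_all

lemma vertex_index_eq_iff [simp]: "vertex_index r = vertex_index s \<longleftrightarrow> r = s"
  by (cases r; cases s) simp_all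

lemma vertex_index_surj:
  assumes "k < 3"
  obtains r where "k = vertex_index r"
proof -
  have "k = vertex_index Star \<or> k = vertex_index Plus \<or> k = vertex_index Minus"
    using assms by auto
  then show ?thesis
    using that by blast
qed

lemma mat_3_eqI:
  assumes "M \<in> carrier_mat 3 3" "N \<in> carrier_mat 3 3" "\<And>r s. entry M r s = entry N r s"
  shows "M = N"
proof (rule eq_matI)
  fix k l assume "k < dim_row N" "l < dim_col N"
  then have "k < 3" "l < 3"
    using assms(2) by auto
  then obtain r s where "k = vertex_index r" "l = vertex_index s"
    by (elim vertex_index_surj)
  then show "M $$ (k, l) = N $$ (k, l)"
    using assms(3)[of r s] by (simp add: entry_def)
qed (use assms in auto)

lemma unit_multiple_carrier [simp]: "unit_multiple x r s \<in> carrier_mat 3 3"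
  by (simp add: unit_multiple_def matrix_unit_def)

lemma entry_unit_multiple [simp]:
  "entry (unit_multiple x r s) u v = (if u = r \<and> v = s then x else 0)"
  by (simp add: entry_def unit_multiple_def matrix_unit_def)

lemma entry_mult:
  assumes "M \<in> carrier_mat 3 3" "N \<in> carrier_mat 3 3"
  shows "entry (M * N) r s = entry M r Star * entry N Star s + entry M r Plus * entry N Plus s +
    entry M r Minus * entry N Minus s"
  using mult_3_index[OF assms] by (simp add: entry_def)

lemma entry_add [simp]:
  assumes "M \<in> carrier_mat 3 3" "N \<in> carrier_mat 3 3"
  shows "entry (M + N) r s = entry M r s + entry N r s"
  using assms by (simp add: entry_def)

lemma matrix_unit_eq: "matrix_unit r s = unit_multiple 1 r s"
  unfolding unit_multiple_def by (rule eq_matI) (simp_all add: matrix_unit_def)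

text \<open>Left multiplication by a multiple of a matrix unit moves row \<open>s\<close> to row
  \<open>r\<close> and scales it; here that row has a single entry that may be nonzero.\<close>

lemma unit_multiple_mult:
  assumes "M \<in> carrier_mat 3 3" and "\<And>t. t \<noteq> u \<Longrightarrow> entry M s t = 0"
  shows "unit_multiple x r s * M = unit_multiple (x * entry M s u) r u"
proof (rule mat_3_eqI)
  fix a b
  show "entry (unit_multiple x r s * M) a b = entry (unit_multiple (x * entry M s u) r u) a b"
    unfolding entry_mult[OF unit_multiple_carrier assms(1)]
    using assms(2)[of b] by (cases s; simp)
qed (rule mult_carrier_mat[OF unit_multiple_carrier assms(1)], rule unit_multiple_carrier)

lemma const_mult_unit_multiple:
  "(x \<cdot>\<^sub>m 1\<^sub>m 3) * unit_multiple y r s = unit_multiple (x * y) r s"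
proof -
  have "(x \<cdot>\<^sub>m 1\<^sub>m 3) * unit_multiple y r s = x \<cdot>\<^sub>m unit_multiple y r s"
    using mult_smult_assoc_mat[OF one_carrier_mat unit_multiple_carrier]
      left_mult_one_mat[OF unit_multiple_carrier] by metis
  then show ?thesis
    by (auto simp: unit_multiple_def)
qed

lemma gelfand_order_iff:
  "M \<in> carrier \<AA> \<longleftrightarrow>
    M \<in> carrier_mat 3 3 \<and> (\<forall>r s. fps_X ^ vanishing r s dvd entry M r s)"
  unfolding gelfand_order_simps all_vertex by (simp add: vanishing_def entry_def)

lemma unit_multiple_in_gelfand_order:
  "fps_X ^ vanishing r s dvd x \<Longrightarrow> unit_multiple x r s \<in> carrier \<AA>"
  unfolding gelfand_order_iff by simp

lemma const_in_gelfand_order: "x \<cdot>\<^sub>m 1\<^sub>m 3 \<in> carrier \<AA>"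
  by (simp add: gelfand_order_simps)

lemma projective_simps [simp]:
  "\<zero>\<^bsub>projective i\<^esub> = 0\<^sub>m 3 3" "add (projective i) = (+)" "smult (projective i) = (*)"
  by (simp_all add: projective_def)

text \<open>Right multiplication by \<open>idem i\<close> keeps column \<open>i\<close> and clears
  the others, so \<open>projective i\<close> consists of the matrices of \<open>\<AA>\<close>
  concentrated in that column.\<close>

lemma projective_iff:
  "M \<in> carrier (projective i) \<longleftrightarrow>
    M \<in> carrier \<AA> \<and> (\<forall>r s. s \<noteq> i \<longrightarrow> entry M r s = 0)"
proof
  assume "M \<in> carrier (projective i)"
  then obtain N where N: "N \<in> carrier \<AA>" "M = N * unit_multiple 1 i i"
    by (auto simp: projective_def idem_def matrix_unit_eq)
  then have N3: "N \<in> carrier_mat 3 3"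
    by (simp add: gelfand_order_iff)
  have "unit_multiple 1 i i \<in> carrier \<AA>"
    by (rule unit_multiple_in_gelfand_order) simp
  then have "M \<in> carrier \<AA>"
    using ring.ring_simprules(5)[OF ring_gelfand_order N(1)] N(2) by (simp add: gelfand_order_simps(1))
  moreover have "entry M r s = 0" if "s \<noteq> i" for r s
    unfolding N(2) entry_mult[OF N3 unit_multiple_carrier] using that by simp
  ultimately show "M \<in> carrier \<AA> \<and> (\<forall>r s. s \<noteq> i \<longrightarrow> entry M r s = 0)"
    by blast
next
  assume M: "M \<in> carrier \<AA> \<and> (\<forall>r s. s \<noteq> i \<longrightarrow> entry M r s = 0)"
  then have M3: "M \<in> carrier_mat 3 3"
    by (simp add: gelfand_order_iff)
  have "M = M * idem i"
    unfolding idem_def matrix_unit_eq[of i i]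
  proof (rule mat_3_eqI[OF M3])
    fix r s
    show "entry M r s = entry (M * unit_multiple 1 i i) r s"
      unfolding entry_mult[OF M3 unit_multiple_carrier] using M by (cases i) auto
  qed (use M3 in simp)
  then have "M \<in> (\<lambda>M. M * idem i) ` carrier \<AA>"
    by (rule image_eqI) (use M in blast)
  then show "M \<in> carrier (projective i)"
    by (simp add: projective_def)
qed

lemma projective_carrier_mat: "M \<in> carrier (projective i) \<Longrightarrow> M \<in> carrier_mat 3 3"
  by (simp add: projective_iff gelfand_order_iff)

lemma projective_entry_dvd: "M \<in> carrier (projective i) \<Longrightarrow> fps_X ^ vanishing r i dvd entry M r i"
  by (simp add: projective_iff gelfand_order_iff)

lemma unit_multiple_in_projective:
  "fps_X ^ vanishing r i dvd x \<Longrightarrow> unit_multiple x r i \<in> carrier (projective i)"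
  unfolding projective_iff by (simp add: unit_multiple_in_gelfand_order)

lemma projective_decomp:
  assumes "M \<in> carrier (projective i)"
  shows "M = unit_multiple (entry M Star i) Star i + unit_multiple (entry M Plus i) Plus i +
    unit_multiple (entry M Minus i) Minus i"
proof (rule mat_3_eqI)
  fix r s
  show "entry M r s = entry (unit_multiple (entry M Star i) Star i +
      unit_multiple (entry M Plus i) Plus i + unit_multiple (entry M Minus i) Minus i) r s"
    using assms by (cases r) (auto simp: projective_iff)
qed (use projective_carrier_mat[OF assms] in auto)

lemma unit_multiple_mult_projective:
  assumes "M \<in> carrier (projective i)"
  shows "unit_multiple x r s * M = unit_multiple (x * entry M s i) r i"
  using assms by (intro unit_multiple_mult) (auto simp: projective_iff gelfand_order_iff)

section \<open>Quotients of projective modules\<close>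

lemma complex_space_simps [simp]:
  "carrier (complex_space V) = carrier V" "\<zero>\<^bsub>complex_space V\<^esub> = \<zero>\<^bsub>V\<^esub>"
  "add (complex_space V) = add V"
  "c \<odot>\<^bsub>complex_space V\<^esub> v = (fps_const c \<cdot>\<^sub>m 1\<^sub>m 3) \<odot>\<^bsub>V\<^esub> v"
  by (simp_all add: complex_space_def)

text \<open>The constant scalar matrices form the image of a unital ring homomorphism from the
  complex numbers to \<open>\<AA>\<close>, along which the action is restricted.\<close>

lemma vectorspace_complex_space:
  assumes "left_module \<AA> V"
  shows "vectorspace class_ring (complex_space V)"
proof -
  interpret left_module \<AA> V by (rule assms)
  let ?c = "\<lambda>c :: complex. fps_const c \<cdot>\<^sub>m 1\<^sub>m 3"
  have const: "?c a \<in> carrier \<AA>" "?c (a + b) = ?c a \<oplus>\<^bsub>\<AA>\<^esub> ?c b"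
    "?c (a * b) = ?c a \<otimes>\<^bsub>\<AA>\<^esub> ?c b" "(1 :: complex fps) \<cdot>\<^sub>m 1\<^sub>m 3 = \<one>\<^bsub>\<AA>\<^esub>" for a b
  proof -
    show "?c a \<in> carrier \<AA>"
      by (rule const_in_gelfand_order)
    show "?c (a + b) = ?c a \<oplus>\<^bsub>\<AA>\<^esub> ?c b"
      unfolding gelfand_order_simps
      by (rule eq_matI)
        (simp_all add: fps_const_add[symmetric] distrib_right del: fps_const_add)
    show "?c (a * b) = ?c a \<otimes>\<^bsub>\<AA>\<^esub> ?c b"
      unfolding gelfand_order_simps
      by (subst mult_smult_assoc_mat[of _ 3 3 _ 3]) (auto simp flip: fps_const_mult)
    show "(1 :: complex fps) \<cdot>\<^sub>m 1\<^sub>m 3 = \<one>\<^bsub>\<AA>\<^esub>"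
      unfolding gelfand_order_simps by (rule eq_matI) simp_all
  qed
  have "abelian_group (complex_space V)"
  proof (rule abelian_groupI)
    fix v assume "v \<in> carrier (complex_space V)"
    then show "\<exists>w \<in> carrier (complex_space V).
        w \<oplus>\<^bsub>complex_space V\<^esub> v = \<zero>\<^bsub>complex_space V\<^esub>"
      using M.l_neg M.a_inv_closed by auto
  qed (auto simp: M.a_ac)
  moreover have "cring (class_ring :: complex ring)"
    by (rule class_cring.cring_axioms)
  ultimately have "Module.module class_ring (complex_space V)"
    by (intro Module.moduleI)
      (simp_all add: const smult_closed smult_l_distr smult_r_distr smult_assoc1 smult_one)
  then show ?thesis
    by (intro vectorspace.intro class_field)
qed

text \<open>A presentation of \<open>V\<close> as a quotient of \<open>projective i\<close>. Finite
  dimension is left out so that it can be derived for the modules constructed later.\<close>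

locale projective_quotient = left_module \<AA> V
  for V :: "(complex fps mat, 'v) module" +
  fixes i :: vertex and h :: "complex fps mat \<Rightarrow> 'v"
  assumes hom: "h \<in> module_hom \<AA> (projective i) V"
    and surj: "h ` carrier (projective i) = carrier V"
begin

text \<open>The restriction of \<open>h\<close> to the component at \<open>r\<close> of the
  projective module, read as a map on the ideal \<open>(t^(vanishing r i))\<close>.\<close>

definition gen :: "vertex \<Rightarrow> complex fps \<Rightarrow> 'v"
  where "gen r x = h (unit_multiple x r i)"

lemma h_closed: "M \<in> carrier (projective i) \<Longrightarrow> h M \<in> carrier V"
  using surj by blast

lemma h_add:
  "\<lbrakk>M \<in> carrier (projective i); N \<in> carrier (projective i)\<rbrakk> \<Longrightarrow> h (M + N) = h M \<oplus>\<^bsub>V\<^esub> h N"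
  using module_hom_add[OF hom] by simp

lemma h_smult:
  "\<lbrakk>A \<in> carrier \<AA>; M \<in> carrier (projective i)\<rbrakk> \<Longrightarrow> A \<odot>\<^bsub>V\<^esub> h M = h (A * M)"
  using module_hom_smult[OF hom] by simp

lemma gen_closed: "fps_X ^ vanishing r i dvd x \<Longrightarrow> gen r x \<in> carrier V"
  unfolding gen_def by (intro h_closed unit_multiple_in_projective)

lemma gen_add:
  assumes "fps_X ^ vanishing r i dvd x" "fps_X ^ vanishing r i dvd y"
  shows "gen r (x + y) = gen r x \<oplus>\<^bsub>V\<^esub> gen r y"
proof -
  have "unit_multiple (x + y) r i = unit_multiple x r i + unit_multiple y r i"
    by (rule mat_3_eqI) auto
  then show ?thesis
    unfolding gen_def by (simp add: h_add unit_multiple_in_projective assms)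
qed

lemma gen_const:
  assumes "fps_X ^ vanishing r i dvd x"
  shows "gen r (fps_const c * x) = (fps_const c \<cdot>\<^sub>m 1\<^sub>m 3) \<odot>\<^bsub>V\<^esub> gen r x"
  unfolding gen_def
  by (simp add: h_smult const_in_gelfand_order unit_multiple_in_projective assms
      const_mult_unit_multiple)

lemma unit_multiple_smult_h:
  assumes "fps_X ^ vanishing r s dvd y" "M \<in> carrier (projective i)"
  shows "unit_multiple y r s \<odot>\<^bsub>V\<^esub> h M = gen r (y * entry M s i)"
  unfolding gen_def
  by (simp add: h_smult unit_multiple_in_gelfand_order assms
      unit_multiple_mult_projective[OF assms(2)])

text \<open>In these coordinates the order acts by multiplying power series and changing the
  vertex.\<close>

lemma unit_multiple_smult_gen:
  assumes "fps_X ^ vanishing r s dvd y" "fps_X ^ vanishing s i dvd x"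
  shows "unit_multiple y r s \<odot>\<^bsub>V\<^esub> gen s x = gen r (y * x)"
  using unit_multiple_smult_h[OF assms(1) unit_multiple_in_projective[OF assms(2)]]
  by (simp add: gen_def)

lemma h_decomp:
  assumes "M \<in> carrier (projective i)"
  shows "h M = gen Star (entry M Star i) \<oplus>\<^bsub>V\<^esub> gen Plus (entry M Plus i) \<oplus>\<^bsub>V\<^esub>
    gen Minus (entry M Minus i)"
proof -
  have u: "unit_multiple (entry M r i) r i \<in> carrier (projective i)" for r
    by (intro unit_multiple_in_projective projective_entry_dvd assms)
  have "unit_multiple (entry M Star i) Star i + unit_multiple (entry M Plus i) Plus i
      \<in> carrier (projective i)"
    using abelian_monoid.a_closed[OF abelian_group.axioms(1)[OF left_module.axioms(2)[OF
          left_module_projective]] u u] by simp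
  then show ?thesis
    unfolding gen_def by (subst projective_decomp[OF assms]) (simp add: h_add u)
qed

text \<open>The idempotent at \<open>r\<close> selects row \<open>r\<close>, and the entries in that
  row of \<open>projective i\<close> fill the whole ideal.\<close>

lemma component_eq: "component V r = gen r ` {x. fps_X ^ vanishing r i dvd x}"
proof -
  have "idem r \<odot>\<^bsub>V\<^esub> h M = gen r (entry M r i)" if "M \<in> carrier (projective i)" for M
    using unit_multiple_smult_h[of r r 1 M] that by (simp add: idem_def matrix_unit_eq)
  then have "component V r = (\<lambda>M. gen r (entry M r i)) ` carrier (projective i)"
    unfolding component_def surj[symmetric] image_image by (rule image_cong[OF refl])
  also have "\<dots> = gen r ` (\<lambda>M. entry M r i) ` carrier (projective i)"
    by (simp only: image_image)
  also have "(\<lambda>M. entry M r i) ` carrier (projective i) = {x. fps_X ^ vanishing r i dvd x}"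
  proof (intro equalityI subsetI)
    fix x :: "complex fps" assume "x \<in> {x. fps_X ^ vanishing r i dvd x}"
    then show "x \<in> (\<lambda>M. entry M r i) ` carrier (projective i)"
      by (intro image_eqI[of _ _ "unit_multiple x r i"]) (simp_all add: unit_multiple_in_projective)
  qed (auto simp: projective_entry_dvd)
  finally show ?thesis .
qed

sublocale complex_space: vectorspace class_ring "complex_space V"
  by (rule vectorspace_complex_space[OF left_module_axioms])

lemma power_series_map_gen: "power_series_map (complex_space V) (vanishing r i) (gen r)"
  by unfold_locales (simp_all add: gen_closed gen_add gen_const)

lemma subspace_component: "subspace class_ring (component V r) (complex_space V)"
proof (intro subspace.intro submodule.intro)
  show "vectorspace class_ring (complex_space V)" "Module.module class_ring (complex_space V)"
    by unfold_locales
  interpret power_series_map "complex_space V" "vanishing r i" "gen r"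
    by (rule power_series_map_gen)
  show "component V r \<subseteq> carrier (complex_space V)"
    using map_closed by (auto simp: component_eq)
  show "\<zero>\<^bsub>complex_space V\<^esub> \<in> component V r"
    unfolding component_eq map_zero[symmetric] by (intro imageI) simp
  fix v w assume "v \<in> component V r" "w \<in> component V r"
  then show "v \<oplus>\<^bsub>complex_space V\<^esub> w \<in> component V r"
    unfolding component_eq by (auto simp flip: gen_add)
next
  fix c :: complex and v assume "v \<in> component V r"
  then show "c \<odot>\<^bsub>complex_space V\<^esub> v \<in> component V r"
    unfolding component_eq by (auto simp flip: gen_const)
qed

text \<open>With the component itself as target the map becomes onto, as the dimension formula
  \<open>dim_image\<close> requires.\<close>

lemma power_series_map_component:
  "power_series_map (complex_space V\<lparr>carrier := component V r\<rparr>) (vanishing r i) (gen r)"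
proof (intro power_series_map.intro power_series_map_axioms.intro)
  show "vectorspace class_ring (complex_space V\<lparr>carrier := component V r\<rparr>)"
    by (rule complex_space.subspace_is_vs[OF subspace_component])
qed (simp_all add: component_eq gen_add gen_const)

end

section \<open>Kernels of presentations and their exponents\<close>

lemma (in left_module) smult_zero: "a \<in> carrier R \<Longrightarrow> a \<odot>\<^bsub>M\<^esub> \<zero>\<^bsub>M\<^esub> = \<zero>\<^bsub>M\<^esub>"
  using smult_r_distr[of a "\<zero>\<^bsub>M\<^esub>" "\<zero>\<^bsub>M\<^esub>"] smult_closed[of a "\<zero>\<^bsub>M\<^esub>"] by simp

text \<open>The exponents of the proper submodules of finite codimension of \<open>P\<^sub>i\<close>.\<close>

definition admissible :: "vertex \<Rightarrow> (vertex \<Rightarrow> nat) \<Rightarrow> bool"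
  where "admissible i n \<longleftrightarrow>
    0 < n i \<and> (\<forall>r. vanishing r i \<le> n r) \<and> (\<forall>r s. n r \<le> n s + vanishing r s)"

text \<open>The kernel of \<open>h\<close> is recorded by its ideal \<open>(t^(n r))\<close> at each
  vertex. Its stability under \<open>\<AA>\<close> is a consequence, see
  \<open>exponents_stable\<close>.\<close>

locale projective_quotient_exponents = projective_quotient V i h
  for V :: "(complex fps mat, 'v) module" and i h +
  fixes n :: "vertex \<Rightarrow> nat"
  assumes vanishing_le: "vanishing r i \<le> n r"
    and gen_eq_zero_iff:
      "fps_X ^ vanishing r i dvd x \<Longrightarrow> gen r x = \<zero>\<^bsub>V\<^esub> \<longleftrightarrow> fps_X ^ n r dvd x"

text \<open>Finite dimension makes the kernel nonzero at every vertex. It is an ideal there because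
  \<open>unit_multiple x r r\<close> acts on the component at \<open>r\<close> as multiplication by
  \<open>x\<close>.\<close>

lemma (in projective_quotient) ex_exponents:
  assumes "fin_dim_module V"
  shows "\<exists>n. projective_quotient_exponents V i h n"
proof -
  have "\<exists>m. {x. fps_X ^ vanishing r i dvd x \<and> gen r x = \<zero>\<^bsub>V\<^esub>} = {x. fps_X ^ m dvd x}" for r
  proof -
    interpret power_series_map "complex_space V" "vanishing r i" "gen r"
      by (rule power_series_map_gen)
    have "\<exists>z. fps_X ^ vanishing r i dvd z \<and> z \<noteq> 0 \<and> gen r z = \<zero>\<^bsub>V\<^esub>"
      using finite_dim_kernel assms by (simp add: fin_dim_module_def)
    then obtain z where z: "fps_X ^ vanishing r i dvd z" "z \<noteq> 0" "gen r z = \<zero>\<^bsub>V\<^esub>"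
      by blast
    show ?thesis
    proof (rule fps_ideal_principal[of "{x. fps_X ^ vanishing r i dvd x \<and> gen r x = \<zero>\<^bsub>V\<^esub>}" z])
      fix x y assume y: "y \<in> {x. fps_X ^ vanishing r i dvd x \<and> gen r x = \<zero>\<^bsub>V\<^esub>}"
      have "gen r (x * y) = unit_multiple x r r \<odot>\<^bsub>V\<^esub> \<zero>\<^bsub>V\<^esub>"
        using unit_multiple_smult_gen[of r r x y] y by simp
      then show "x * y \<in> {x. fps_X ^ vanishing r i dvd x \<and> gen r x = \<zero>\<^bsub>V\<^esub>}"
        using y by (simp add: smult_zero unit_multiple_in_gelfand_order)
    qed (use z in blast)+
  qed
  then obtain n where n: "\<And>r. {x. fps_X ^ vanishing r i dvd x \<and> gen r x = \<zero>\<^bsub>V\<^esub>} = {x. fps_X ^ n r dvd x}"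
    by metis
  have "projective_quotient_exponents V i h n"
  proof unfold_locales
    fix r
    \<comment> \<open>The generator of the kernel lies in the source of \<open>gen r\<close>, which
      is the inequality of exponents.\<close>
    have "fps_X ^ n r \<in> {x. fps_X ^ vanishing r i dvd x \<and> gen r x = \<zero>\<^bsub>V\<^esub>}"
      unfolding n by simp
    then show "vanishing r i \<le> n r"
      by simp
  next
    fix r and x :: "complex fps" assume "fps_X ^ vanishing r i dvd x"
    then show "gen r x = \<zero>\<^bsub>V\<^esub> \<longleftrightarrow> fps_X ^ n r dvd x"
      using n[of r] by blast
  qed
  then show ?thesis
    by blast
qed

context projective_quotient_exponents
begin

lemma component_dim_eq: "component_dim V r = n r - vanishing r i"
proof -
  interpret W: power_series_map "complex_space V\<lparr>carrier := component V r\<rparr>" "vanishing r i" "gen r"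
    by (rule power_series_map_component)
  show ?thesis
    unfolding component_dim_def
    by (rule W.dim_image[OF vanishing_le]) (simp_all add: gen_eq_zero_iff component_eq)
qed

lemma dimension_vector_eq:
  "dimension_vector V =
    (n Minus - vanishing Minus i, n Star - vanishing Star i, n Plus - vanishing Plus i)"
  by (simp add: dimension_vector_def component_dim_eq)

text \<open>The smallest multiple of the matrix unit from \<open>s\<close> to \<open>r\<close> that
  lies in \<open>\<AA>\<close> carries the generator of the kernel at \<open>s\<close> into the
  kernel at \<open>r\<close>.\<close>

lemma exponents_stable: "n r \<le> n s + vanishing r s"
proof -
  have "gen r (fps_X ^ vanishing r s * fps_X ^ n s)
      = unit_multiple (fps_X ^ vanishing r s) r s \<odot>\<^bsub>V\<^esub> gen s (fps_X ^ n s)"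
    by (rule unit_multiple_smult_gen[symmetric]) (simp_all add: vanishing_le)
  also have "gen s (fps_X ^ n s) = \<zero>\<^bsub>V\<^esub>"
    by (simp add: gen_eq_zero_iff vanishing_le)
  finally have "gen r (fps_X ^ (n s + vanishing r s)) = \<zero>\<^bsub>V\<^esub>"
    by (simp add: smult_zero unit_multiple_in_gelfand_order power_add mult.commute)
  \<comment> \<open>This places the product in the ideal on which the kernel of \<open>gen r\<close>
    is described.\<close>
  moreover have "vanishing r i \<le> n s + vanishing r s"
    using vanishing_triangle[of r i s] vanishing_le[of s] by linarith
  ultimately show ?thesis
    using gen_eq_zero_iff[of r "fps_X ^ (n s + vanishing r s)"] by simp
qed

lemma gen_eq_iff:
  assumes x: "fps_X ^ vanishing r i dvd x" and y: "fps_X ^ vanishing r i dvd y"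
  shows "gen r x = gen r y \<longleftrightarrow> fps_X ^ n r dvd x - y"
proof -
  have d: "fps_X ^ vanishing r i dvd x - y"
    using x y by (rule dvd_diff)
  have "gen r x = gen r (x - y) \<oplus>\<^bsub>V\<^esub> gen r y"
    unfolding gen_add[OF d y, symmetric] by simp
  also have "\<dots> = gen r y \<longleftrightarrow> gen r (x - y) = \<zero>\<^bsub>V\<^esub>"
    by (rule M.add.r_cancel_one[OF gen_closed[OF y] gen_closed[OF d]])
  also have "\<dots> \<longleftrightarrow> fps_X ^ n r dvd x - y"
    by (rule gen_eq_zero_iff[OF d])
  finally show ?thesis .
qed

text \<open>The idempotents separate the components, so the fibres of \<open>h\<close> depend on
  \<open>n\<close> alone.\<close>

lemma h_eq_iff:
  assumes M: "M \<in> carrier (projective i)" and N: "N \<in> carrier (projective i)"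
  shows "h M = h N \<longleftrightarrow> (\<forall>r. fps_X ^ n r dvd entry M r i - entry N r i)"
proof -
  have "h M = h N \<longleftrightarrow> (\<forall>r. gen r (entry M r i) = gen r (entry N r i))"
  proof
    assume eq: "h M = h N"
    \<comment> \<open>The factor 1 brings both sides into the form of an action of
      \<open>unit_multiple 1 r r\<close> on \<open>h M\<close> and \<open>h N\<close>.\<close>
    have "gen r (1 * entry M r i) = gen r (1 * entry N r i)" for r
      by (simp only: unit_multiple_smult_h[of r r 1, OF _ M, symmetric] vanishing_simps
          unit_multiple_smult_h[of r r 1, OF _ N, symmetric] power_0 one_dvd eq)
    then show "\<forall>r. gen r (entry M r i) = gen r (entry N r i)"
      by simp
  next
    assume "\<forall>r. gen r (entry M r i) = gen r (entry N r i)"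
    then show "h M = h N"
      unfolding h_decomp[OF M] h_decomp[OF N] by metis
  qed
  then show ?thesis
    by (simp add: gen_eq_iff projective_entry_dvd M N)
qed

lemma nonzero_module_iff: "nonzero_module V \<longleftrightarrow> 0 < n i"
proof
  assume "0 < n i"
  then have "gen i 1 \<noteq> \<zero>\<^bsub>V\<^esub>"
    by (simp add: gen_eq_zero_iff fps_X_power_dvd_iff)
  then show "nonzero_module V"
    unfolding nonzero_module_def using gen_closed[of i 1] by auto
next
  assume nz: "nonzero_module V"
  show "0 < n i"
  proof (rule ccontr)
    assume "\<not> 0 < n i"
    \<comment> \<open>If \<open>n i = 0\<close>, stability leaves no gap at any vertex between the
      kernel and the whole ideal.\<close>
    then have "n r \<le> vanishing r i" for r
      using exponents_stable[of r i] by simp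
    then have "fps_X ^ n r dvd x" if "fps_X ^ vanishing r i dvd x" for r and x :: "complex fps"
      using that by (meson dvd_trans fps_X_power_dvd_power_iff)
    then have "gen r x = \<zero>\<^bsub>V\<^esub>" if "fps_X ^ vanishing r i dvd x" for r x
      using that gen_eq_zero_iff by blast
    then have "h M = \<zero>\<^bsub>V\<^esub>" if "M \<in> carrier (projective i)" for M
      using that by (simp add: h_decomp projective_entry_dvd)
    then have "carrier V \<subseteq> {\<zero>\<^bsub>V\<^esub>}"
      unfolding surj[symmetric] by auto
    then show False
      using nz M.zero_closed unfolding nonzero_module_def by blast
  qed
qed

lemma admissible_exponents: "nonzero_module V \<Longrightarrow> admissible i n"
  by (simp add: admissible_def nonzero_module_iff vanishing_le exponents_stable)

text \<open>Of the two arrows composed, \<open>A\<close> carries the factor \<open>t\<close> and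
  \<open>B\<close> the factor 1, so a round trip from any vertex multiplies by
  \<open>t\<close>.\<close>

lemma C_op_gen: "C_op V i (gen i x) = gen i (fps_X * x)"
proof (cases i)
  case Star
  then have "B_plus V (gen Star x) = gen Plus x"
    using unit_multiple_smult_gen[of Plus Star 1 x]
    by (simp add: B_plus_def matrix_unit_eq)
  moreover have "A_plus V (gen Plus x) = gen Star (fps_X * x)"
    using unit_multiple_smult_gen[of Star Plus fps_X x] Star
    by (simp add: A_plus_def vanishing_def flip: unit_multiple_def)
  ultimately show ?thesis
    using Star by simp
next
  case Plus
  then have "A_plus V (gen Plus x) = gen Star (fps_X * x)"
    using unit_multiple_smult_gen[of Star Plus fps_X x]
    by (simp add: A_plus_def vanishing_def flip: unit_multiple_def)
  moreover have "B_plus V (gen Star (fps_X * x)) = gen Plus (fps_X * x)"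
    using unit_multiple_smult_gen[of Plus Star 1 "fps_X * x"] Plus
    by (simp add: B_plus_def matrix_unit_eq vanishing_def)
  ultimately show ?thesis
    using Plus by simp
next
  case Minus
  then have "A_minus V (gen Minus x) = gen Star (fps_X * x)"
    using unit_multiple_smult_gen[of Star Minus fps_X x]
    by (simp add: A_minus_def vanishing_def flip: unit_multiple_def)
  moreover have "B_minus V (gen Star (fps_X * x)) = gen Minus (fps_X * x)"
    using unit_multiple_smult_gen[of Minus Star 1 "fps_X * x"] Minus
    by (simp add: B_minus_def matrix_unit_eq vanishing_def)
  ultimately show ?thesis
    using Minus by simp
qed

lemma nilpotency_degree_eq: "nilpotency_degree V i = n i"
proof -
  have iter: "(C_op V i ^^ m) (gen i x) = gen i (fps_X ^ m * x)" for m x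
    by (induction m) (simp_all add: C_op_gen mult.assoc)
  have "(\<forall>v \<in> component V i. (C_op V i ^^ m) v = \<zero>\<^bsub>V\<^esub>) \<longleftrightarrow> n i \<le> m" for m
  proof -
    have "(\<forall>v \<in> component V i. (C_op V i ^^ m) v = \<zero>\<^bsub>V\<^esub>) \<longleftrightarrow> (\<forall>x. fps_X ^ n i dvd fps_X ^ m * (x :: complex fps))"
      by (simp add: component_eq iter gen_eq_zero_iff)
    also have "\<dots> \<longleftrightarrow> n i \<le> m"
    proof
      assume "\<forall>x. fps_X ^ n i dvd fps_X ^ m * (x :: complex fps)"
      then have "fps_X ^ n i dvd fps_X ^ m * (1 :: complex fps)" ..
      then show "n i \<le> m"
        by simp
    next
      assume "n i \<le> m"
      then show "\<forall>x. fps_X ^ n i dvd fps_X ^ m * (x :: complex fps)"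
        by (intro allI dvd_mult2) simp
    qed
    finally show ?thesis .
  qed
  then show ?thesis
    unfolding nilpotency_degree_def by (intro Least_equality) auto
qed

text \<open>A converse to \<open>ex_exponents\<close>: at each of the three vertices finitely many
  powers of \<open>t\<close> span the component, and together they span \<open>V\<close>.\<close>

lemma fin_dim: "fin_dim_module V"
proof -
  define A where "A = (\<Union>r. (\<lambda>k. gen r (fps_X ^ k)) ` {vanishing r i..<n r})"
  have "r \<in> {Star, Plus, Minus}" for r
    by (cases r) simp_all
  then have "finite (UNIV :: vertex set)"
    by (intro finite_subset[of UNIV "{Star, Plus, Minus}"] subsetI finite.intros)
  then have "finite A"
    unfolding A_def by (intro finite_UN_I) auto
  moreover have A: "A \<subseteq> carrier (complex_space V)"
    by (auto simp: A_def intro!: gen_closed)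
  moreover have "complex_space.span A = carrier (complex_space V)"
  proof (rule equalityI)
    interpret span: submodule class_ring "complex_space.span A" "complex_space V"
      by (rule complex_space.span_is_submodule[OF A])
    have gen: "gen r x \<in> complex_space.span A" if "fps_X ^ vanishing r i dvd x" for r x
    proof -
      interpret power_series_map "complex_space V" "vanishing r i" "gen r"
        by (rule power_series_map_gen)
      have "gen r x \<in> complex_space.span ((\<lambda>k. gen r (fps_X ^ k)) ` {vanishing r i..<n r})"
        by (rule map_in_span[OF vanishing_le _ that]) (simp add: gen_eq_zero_iff)
      also have "\<dots> \<subseteq> complex_space.span A"
        by (rule complex_space.span_is_monotone) (auto simp: A_def)
      finally show ?thesis .
    qed
    have "h M \<in> complex_space.span A" if "M \<in> carrier (projective i)" for M
      unfolding h_decomp[OF that]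
      by (intro span.m_closed[unfolded complex_space_simps] gen projective_entry_dvd that)
    then show "carrier (complex_space V) \<subseteq> complex_space.span A"
      unfolding complex_space_simps surj[symmetric] by (rule image_subsetI)
  qed (rule complex_space.span_is_subset2[OF A])
  ultimately have "complex_space.fin_dim"
    unfolding complex_space.fin_dim_def by (intro exI[of _ A] conjI)
  then show ?thesis
    unfolding fin_dim_module_def by (intro conjI left_module_axioms)
qed

lemma cyclic_of_type: "cyclic_of_type i V"
  unfolding cyclic_of_type_def by (intro conjI fin_dim bexI[OF _ hom] surj)

end

section \<open>Classification of the cyclic modules\<close>

lemma cyclic_module_exponents:
  assumes "cyclic_of_type i V" "nonzero_module V"
  obtains h n where "projective_quotient_exponents V i h n" "admissible i n"
proof -
  obtain h where V: "fin_dim_module V" and h: "h \<in> module_hom \<AA> (projective i) V"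
      "h ` carrier (projective i) = carrier V"
    using assms(1) unfolding cyclic_of_type_def by blast
  interpret projective_quotient V i h
    using V h by (intro projective_quotient.intro projective_quotient_axioms.intro)
      (simp_all add: fin_dim_module_def)
  obtain n where n: "projective_quotient_exponents V i h n"
    using ex_exponents[OF V] by blast
  then show ?thesis
    using that projective_quotient_exponents.admissible_exponents assms(2) by blast
qed

text \<open>Both modules are quotients of \<open>projective i\<close> by the same submodule.\<close>

lemma left_module_isomorphic_if_same_exponents:
  assumes "projective_quotient_exponents V i h n" "projective_quotient_exponents W i k n"
  shows "left_module_isomorphic \<AA> V W"
proof -
  interpret V: projective_quotient_exponents V i h n by (rule assms(1))
  interpret W: projective_quotient_exponents W i k n by (rule assms(2))
  show ?thesis
    by (rule left_module_isomorphicI[OF left_module_projective V.hom V.surj W.hom W.surj])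
      (simp add: V.h_eq_iff W.h_eq_iff)
qed

lemma cyclic_modules_isomorphic:
  assumes "cyclic_of_type i V" "nonzero_module V" "cyclic_of_type i W" "nonzero_module W"
    and dim: "dimension_vector V = dimension_vector W"
  shows "left_module_isomorphic \<AA> V W"
proof -
  obtain h n where V: "projective_quotient_exponents V i h n" "admissible i n"
    using assms(1,2) by (rule cyclic_module_exponents)
  obtain k m where W: "projective_quotient_exponents W i k m" "admissible i m"
    using assms(3,4) by (rule cyclic_module_exponents)
  have "n r - vanishing r i = m r - vanishing r i" for r
    using dim unfolding projective_quotient_exponents.dimension_vector_eq[OF V(1)]
      projective_quotient_exponents.dimension_vector_eq[OF W(1)] by (cases r) simp_all
  \<comment> \<open>Admissibility bounds both exponents below by \<open>vanishing r i\<close>, so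
    the natural subtraction loses nothing and can be undone.\<close>
  then have "n r = m r" for r
    using V(2) W(2) unfolding admissible_def by (metis le_add_diff_inverse)
  then have "n = m" ..
  then show ?thesis
    using V(1) W(1) left_module_isomorphic_if_same_exponents by blast
qed

section \<open>Realisation by truncated power series\<close>

text \<open>A left inverse of \<open>vertex_index\<close>; indices from 2 on default to
  \<open>Minus\<close>.\<close>

definition index_vertex :: "nat \<Rightarrow> vertex"
  where "index_vertex k = (if k = 0 then Star else if k = 1 then Plus else Minus)"

lemma index_vertex_vertex_index [simp]: "index_vertex (vertex_index r) = r"
  by (cases r) (simp_all add: index_vertex_def)

text \<open>Column \<open>i\<close> with each entry in normal form modulo \<open>t^(n r)\<close>.
  These representatives replace cosets and live in the carrier type that \<open>realised\<close>
  prescribes.\<close>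

definition truncation :: "(vertex \<Rightarrow> nat) \<Rightarrow> vertex \<Rightarrow> complex fps mat \<Rightarrow> complex fps vec"
  where "truncation n i M =
    vec 3 (\<lambda>k. fps_cutoff (n (index_vertex k)) (entry M (index_vertex k) i))"

lemma truncation_eq_iff:
  "truncation n i M = truncation n i N \<longleftrightarrow> (\<forall>r. fps_X ^ n r dvd entry M r i - entry N r i)"
proof
  assume eq: "truncation n i M = truncation n i N"
  show "\<forall>r. fps_X ^ n r dvd entry M r i - entry N r i"
  proof
    fix r
    have "truncation n i M $ vertex_index r = truncation n i N $ vertex_index r"
      by (simp only: eq)
    then show "fps_X ^ n r dvd entry M r i - entry N r i"
      by (simp add: truncation_def fps_cutoff_eq_iff_dvd)
  qed
next
  assume "\<forall>r. fps_X ^ n r dvd entry M r i - entry N r i"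
  then show "truncation n i M = truncation n i N"
    unfolding truncation_def by (intro eq_vecI) (simp_all add: fps_cutoff_eq_iff_dvd)
qed

lemma truncation_add:
  assumes "M \<in> carrier_mat 3 3" "N \<in> carrier_mat 3 3"
  shows "truncation n i M + truncation n i N = truncation n i (M + N)"
  using assms unfolding truncation_def by (intro eq_vecI) (simp_all add: fps_cutoff_add)

text \<open>An entry of \<open>A\<close> contributes \<open>vanishing r s\<close> factors
  \<open>t\<close> and a difference of entries contributes \<open>n s\<close>; by
  \<open>stable\<close> the product vanishes modulo \<open>t^(n r)\<close>. Hence the action
  descends to truncations.\<close>

lemma truncation_mult_cong:
  assumes A: "A \<in> carrier \<AA>" and M: "M \<in> carrier_mat 3 3" and N: "N \<in> carrier_mat 3 3"
    and stable: "\<And>r s. n r \<le> n s + vanishing r s"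
    and eq: "truncation n i M = truncation n i N"
  shows "truncation n i (A * M) = truncation n i (A * N)"
  unfolding truncation_eq_iff
proof
  fix r
  have A3: "A \<in> carrier_mat 3 3"
    using A by (simp add: gelfand_order_iff)
  have dvd: "fps_X ^ n r dvd entry A r s * (entry M s i - entry N s i)" for s
  proof -
    have "fps_X ^ n r dvd (fps_X :: complex fps) ^ (vanishing r s + n s)"
      using stable[of r s] by (simp add: add.commute)
    also have "\<dots> dvd entry A r s * (entry M s i - entry N s i)"
      unfolding power_add using A eq by (intro mult_dvd_mono) (auto simp: gelfand_order_iff truncation_eq_iff)
    finally show ?thesis .
  qed
  have "entry (A * M) r i - entry (A * N) r i =
      entry A r Star * (entry M Star i - entry N Star i) +
      entry A r Plus * (entry M Plus i - entry N Plus i) +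
      entry A r Minus * (entry M Minus i - entry N Minus i)"
    by (simp add: entry_mult[OF A3 M] entry_mult[OF A3 N] algebra_simps)
  then show "fps_X ^ n r dvd entry (A * M) r i - entry (A * N) r i"
    using dvd by (simp add: dvd_add)
qed

text \<open>A scalar acts by lifting a truncated column to \<open>projective i\<close>, multiplying
  there and truncating again. For stable exponents the choice of lift does not matter, by
  \<open>truncation_mult_cong\<close>.\<close>

definition truncated_module ::
  "(vertex \<Rightarrow> nat) \<Rightarrow> vertex \<Rightarrow> (complex fps mat, complex fps vec) module"
  where "truncated_module n i =
    \<lparr>carrier = truncation n i ` carrier (projective i), mult = (\<lambda>u v. u), one = 0\<^sub>v 3,
     zero = 0\<^sub>v 3, add = (+),
     smult = (\<lambda>A v. truncation n i
       (A * (SOME M. M \<in> carrier (projective i) \<and> truncation n i M = v)))\<rparr>"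

lemma truncated_module_exponents:
  assumes "admissible i n"
  shows "projective_quotient_exponents (truncated_module n i) i (truncation n i) n"
proof -
  let ?V = "truncated_module n i"
  have zero: "\<zero>\<^bsub>?V\<^esub> = truncation n i (0\<^sub>m 3 3)"
    by (rule eq_vecI) (auto simp: truncated_module_def truncation_def entry_def index_vertex_def)
  have smult: "A \<odot>\<^bsub>?V\<^esub> truncation n i M = truncation n i (A * M)"
    if A: "A \<in> carrier \<AA>" and M: "M \<in> carrier (projective i)" for A M
  proof -
    define N where "N = (SOME N. N \<in> carrier (projective i) \<and> truncation n i N = truncation n i M)"
    have "N \<in> carrier (projective i) \<and> truncation n i N = truncation n i M"
      unfolding N_def by (rule someI[of _ M]) (simp add: M)
    then have "truncation n i (A * N) = truncation n i (A * M)"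
      using A M assms by (intro truncation_mult_cong) (auto simp: projective_carrier_mat admissible_def)
    then show ?thesis
      by (simp add: truncated_module_def N_def)
  qed
  have add: "truncation n i M \<oplus>\<^bsub>?V\<^esub> truncation n i N = truncation n i (M + N)"
    if "M \<in> carrier (projective i)" "N \<in> carrier (projective i)" for M N
    using that by (simp add: truncated_module_def truncation_add projective_carrier_mat)
  have carrier: "carrier ?V = truncation n i ` carrier (projective i)"
    by (simp add: truncated_module_def)
  have V: "left_module \<AA> ?V" "truncation n i \<in> module_hom \<AA> (projective i) ?V"
    by (rule left_module_image[OF left_module_projective carrier]; simp add: zero add smult)+
  interpret projective_quotient ?V i "truncation n i"
    using V carrier by (intro projective_quotient.intro projective_quotient_axioms.intro) simp_all
  show ?thesis
  proof unfold_locales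
    show "vanishing r i \<le> n r" for r
      using assms by (simp add: admissible_def)
    show "gen r x = \<zero>\<^bsub>?V\<^esub> \<longleftrightarrow> fps_X ^ n r dvd x" for r x
      unfolding gen_def zero truncation_eq_iff by (auto simp: entry_def[of "0\<^sub>m 3 3"])
  qed
qed

lemma realised_if_admissible:
  assumes "admissible i n"
  shows "realised i (n Minus - vanishing Minus i, n Star - vanishing Star i, n Plus - vanishing Plus i)"
proof -
  interpret projective_quotient_exponents "truncated_module n i" i "truncation n i" n
    by (rule truncated_module_exponents[OF assms])
  show ?thesis
    unfolding realised_def
    by (rule exI[of _ "truncated_module n i"])
      (use cyclic_of_type nonzero_module_iff dimension_vector_eq assms in \<open>simp add: admissible_def\<close>)
qed

text \<open>The inequalities between \<open>n Plus\<close> and \<open>n Minus\<close> follow by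
  passing through \<open>Star\<close>. Each of these two exponents is \<open>n Star\<close> or one
  less, which yields the four families of every type.\<close>

lemma admissible_iff:
  "admissible Star n \<longleftrightarrow> 0 < n Star \<and> n Plus \<le> n Star \<and> n Star \<le> n Plus + 1 \<and>
    n Minus \<le> n Star \<and> n Star \<le> n Minus + 1"
  "admissible Plus n \<longleftrightarrow> 0 < n Plus \<and> 0 < n Minus \<and> n Plus \<le> n Star \<and> n Star \<le> n Plus + 1 \<and>
    n Minus \<le> n Star \<and> n Star \<le> n Minus + 1"
  "admissible Minus n \<longleftrightarrow> 0 < n Minus \<and> 0 < n Plus \<and> n Plus \<le> n Star \<and> n Star \<le> n Plus + 1 \<and>
    n Minus \<le> n Star \<and> n Star \<le> n Minus + 1"
  by (simp_all add: admissible_def all_vertex vanishing_def; arith)+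

lemma cyclic_module_invariants:
  assumes "cyclic_of_type i V" "nonzero_module V"
  obtains n where "admissible i n" "nilpotency_degree V i = n i" "dimension_vector V =
    (n Minus - vanishing Minus i, n Star - vanishing Star i, n Plus - vanishing Plus i)"
proof -
  obtain h n where n: "projective_quotient_exponents V i h n" "admissible i n"
    using assms by (rule cyclic_module_exponents)
  interpret projective_quotient_exponents V i h n
    by (rule n(1))
  show ?thesis
    by (rule that[OF n(2) nilpotency_degree_eq dimension_vector_eq])
qed

section \<open>Dimension vectors for the three types\<close>

lemma cyclic_module_Star:
  assumes "cyclic_of_type Star V" "nonzero_module V"
  shows "\<exists>d. (dimension_vector V = (d, d + 1, d) \<or>
            dimension_vector V = (d + 1, d + 1, d + 1) \<or>
            dimension_vector V = (d, d + 1, d + 1) \<or>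
            dimension_vector V = (d + 1, d + 1, d)) \<and>
           nilpotency_degree V Star = d + 1"
proof -
  obtain n where n: "admissible Star n" "nilpotency_degree V Star = n Star" "dimension_vector V =
      (n Minus - vanishing Minus Star, n Star - vanishing Star Star, n Plus - vanishing Plus Star)"
    using assms by (rule cyclic_module_invariants)
  show ?thesis
    using n(1) unfolding n(2,3) admissible_iff
    \<comment> \<open>The nilpotency degree \<open>n Star\<close> has to be \<open>d + 1\<close>,
      and it is positive by admissibility.\<close>
    by (intro exI[of _ "n Star - 1"]) (simp add: vanishing_def; arith)
qed

lemma cyclic_module_Plus:
  assumes "cyclic_of_type Plus V" "nonzero_module V"
  shows "\<exists>d. (dimension_vector V = (d, d, d + 1) \<or>
            dimension_vector V = (d, d + 1, d + 1) \<or>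
            dimension_vector V = (d + 1, d + 1, d + 1) \<or>
            d \<ge> 1 \<and> dimension_vector V = (d - 1, d, d + 1)) \<and>
           nilpotency_degree V Plus = d + 1"
proof -
  obtain n where n: "admissible Plus n" "nilpotency_degree V Plus = n Plus" "dimension_vector V =
      (n Minus - vanishing Minus Plus, n Star - vanishing Star Plus, n Plus - vanishing Plus Plus)"
    using assms by (rule cyclic_module_invariants)
  show ?thesis
    using n(1) unfolding n(2,3) admissible_iff
    \<comment> \<open>In the last family \<open>n Minus = d\<close>, so \<open>d \<ge> 1\<close>
      comes from \<open>0 < n Minus\<close>.\<close>
    by (intro exI[of _ "n Plus - 1"]) (simp add: vanishing_def; arith)
qed

lemma cyclic_module_Minus:
  assumes "cyclic_of_type Minus V" "nonzero_module V"
  shows "\<exists>d. (dimension_vector V = (d + 1, d, d) \<or>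
            dimension_vector V = (d + 1, d + 1, d) \<or>
            dimension_vector V = (d + 1, d + 1, d + 1) \<or>
            d \<ge> 1 \<and> dimension_vector V = (d + 1, d, d - 1)) \<and>
           nilpotency_degree V Minus = d + 1"
proof -
  obtain n where n: "admissible Minus n" "nilpotency_degree V Minus = n Minus" "dimension_vector V =
      (n Minus - vanishing Minus Minus, n Star - vanishing Star Minus, n Plus - vanishing Plus Minus)"
    using assms by (rule cyclic_module_invariants)
  show ?thesis
    using n(1) unfolding n(2,3) admissible_iff
    by (intro exI[of _ "n Minus - 1"]) (simp add: vanishing_def; arith)
qed

lemma realised_Star:
  "realised Star (d, d + 1, d)" "realised Star (d + 1, d + 1, d + 1)"
  "realised Star (d, d + 1, d + 1)" "realised Star (d + 1, d + 1, d)"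
  using realised_if_admissible[of Star "case_vertex (d + 1) d d"]
    realised_if_admissible[of Star "case_vertex (d + 1) (d + 1) (d + 1)"]
    realised_if_admissible[of Star "case_vertex (d + 1) (d + 1) d"]
    realised_if_admissible[of Star "case_vertex (d + 1) d (d + 1)"]
  by (simp_all add: admissible_iff vanishing_def)

text \<open>The exponents, listed in the order \<open>Star\<close>, \<open>Plus\<close>,
  \<open>Minus\<close>, exceed the dimensions by one except at \<open>Plus\<close>.\<close>

lemma realised_Plus:
  "realised Plus (d, d, d + 1)" "realised Plus (d, d + 1, d + 1)"
  "realised Plus (d + 1, d + 1, d + 1)" "d \<ge> 1 \<Longrightarrow> realised Plus (d - 1, d, d + 1)"
  using realised_if_admissible[of Plus "case_vertex (d + 1) (d + 1) (d + 1)"]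
    realised_if_admissible[of Plus "case_vertex (d + 2) (d + 1) (d + 1)"]
    realised_if_admissible[of Plus "case_vertex (d + 2) (d + 1) (d + 2)"]
    realised_if_admissible[of Plus "case_vertex (d + 1) (d + 1) d"]
  by (simp_all add: admissible_iff vanishing_def)

lemma realised_Minus:
  "realised Minus (d + 1, d, d)" "realised Minus (d + 1, d + 1, d)"
  "realised Minus (d + 1, d + 1, d + 1)" "d \<ge> 1 \<Longrightarrow> realised Minus (d + 1, d, d - 1)"
  using realised_if_admissible[of Minus "case_vertex (d + 1) (d + 1) (d + 1)"]
    realised_if_admissible[of Minus "case_vertex (d + 2) (d + 1) (d + 1)"]
    realised_if_admissible[of Minus "case_vertex (d + 2) (d + 2) (d + 1)"]
    realised_if_admissible[of Minus "case_vertex (d + 1) d (d + 1)"]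
  by (simp_all add: admissible_iff vanishing_def)

theorem theorem2p5:
  shows
  "(\<forall>i (V :: (complex fps mat, 'v) module) (W :: (complex fps mat, 'w) module).
      cyclic_of_type i V \<and> nonzero_module V \<and> cyclic_of_type i W \<and> nonzero_module W \<and>
      dimension_vector V = dimension_vector W \<longrightarrow> left_module_isomorphic \<AA> V W)
   \<and>
   \<comment> \<open>(I)\<close>
   (\<forall>V :: (complex fps mat, 'v) module.
      cyclic_of_type Star V \<and> nonzero_module V \<longrightarrow>
      (\<exists>d. (dimension_vector V = (d, d + 1, d) \<or>
            dimension_vector V = (d + 1, d + 1, d + 1) \<or>
            dimension_vector V = (d, d + 1, d + 1) \<or>
            dimension_vector V = (d + 1, d + 1, d)) \<and>
           nilpotency_degree V Star = d + 1)) \<and>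
   (\<forall>d. realised Star (d, d + 1, d) \<and>
        realised Star (d + 1, d + 1, d + 1) \<and>
        realised Star (d, d + 1, d + 1) \<and>
        realised Star (d + 1, d + 1, d))
   \<and>
   \<comment> \<open>(II)\<close>
   (\<forall>V :: (complex fps mat, 'v) module.
      cyclic_of_type Plus V \<and> nonzero_module V \<longrightarrow>
      (\<exists>d. (dimension_vector V = (d, d, d + 1) \<or>
            dimension_vector V = (d, d + 1, d + 1) \<or>
            dimension_vector V = (d + 1, d + 1, d + 1) \<or>
            d \<ge> 1 \<and> dimension_vector V = (d - 1, d, d + 1)) \<and>
           nilpotency_degree V Plus = d + 1)) \<and>
   (\<forall>d. realised Plus (d, d, d + 1) \<and>
        realised Plus (d, d + 1, d + 1) \<and>
        realised Plus (d + 1, d + 1, d + 1) \<and>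
        (d \<ge> 1 \<longrightarrow> realised Plus (d - 1, d, d + 1)))
   \<and>
   \<comment> \<open>(III)\<close>
   (\<forall>V :: (complex fps mat, 'v) module.
      cyclic_of_type Minus V \<and> nonzero_module V \<longrightarrow>
      (\<exists>d. (dimension_vector V = (d + 1, d, d) \<or>
            dimension_vector V = (d + 1, d + 1, d) \<or>
            dimension_vector V = (d + 1, d + 1, d + 1) \<or>
            d \<ge> 1 \<and> dimension_vector V = (d + 1, d, d - 1)) \<and>
           nilpotency_degree V Minus = d + 1)) \<and>
   (\<forall>d. realised Minus (d + 1, d, d) \<and>
        realised Minus (d + 1, d + 1, d) \<and>
        realised Minus (d + 1, d + 1, d + 1) \<and>
        (d \<ge> 1 \<longrightarrow> realised Minus (d + 1, d, d - 1)))"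
  using cyclic_modules_isomorphic cyclic_module_Star cyclic_module_Plus cyclic_module_Minus
    realised_Star realised_Plus realised_Minus by (intro conjI allI impI) blast+

end
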